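(* Let $\mathcal{C}=\{d_1,\dots,d_n\}$ be a finite set of documents and let $V$ be a finite set of semantic dimensions. Assume $q(v)\ge 0$, $\tilde{\rho}_i\ge 0$, and $d_i(v)\ge 0$ for all $v\in V$ and all $i\in\{1,\dots,n\}$. Then the set function $F:2^{\mathcal{C}}\to\mathbb{R}$ given by $$F(S)=\sum_{v\in V} q(v)\,\max_{d_i\in S}\left[\sqrt{\tilde{\rho}_i}\,d_i(v)\right]$$ (with the maximum over the empty set taken to be $0$) is monotone submodular. That is, $F(A)\le F(B)$ whenever $A\subseteq B\subseteq\mathcal{C}$, and $F(A\cup\{d_j\})-F(A)\ge F(B\cup\{d_j\})-F(B)$ whenever $A\subseteq B\subseteq\mathcal{C}$ and $d_j\in\mathcal{C}\setminus B$.
   Context: The real number $q(v)$ is the representation value of a fixed query $q$ on dimension $v$. The real number $d_i(v)$ is the representation value of document $d_i$ on dimension $v$. The real number $\tilde{\rho}_i$ is the relevance weight of document $d_i$. Documents with different indices are distinct elements of $\mathcal{C}$, even if their representation values coincide. *)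

theory Defs
  imports Complex_Main
begin

(* Documents are bare elements of a type 'd; their weights and representation values are
   functions on documents.  Distinct documents may therefore have equal representation values.
   The convention max {} = 0 is made explicit, since Max {} is unspecified. *)

definition max_or_zero :: "('d \<Rightarrow> real) \<Rightarrow> 'd set \<Rightarrow> real" where
  "max_or_zero f S = (if S = {} then 0 else Max (f ` S))"

definition coverage ::
  "'v set \<Rightarrow> ('v \<Rightarrow> real) \<Rightarrow> ('d \<Rightarrow> real) \<Rightarrow> ('d \<Rightarrow> 'v \<Rightarrow> real) \<Rightarrow> 'd set \<Rightarrow> real" where
  "coverage V q \<rho> rep S = (\<Sum>v\<in>V. q v * max_or_zero (\<lambda>d. sqrt (\<rho> d) * rep d v) S)"

definition submodular_on :: "'d set \<Rightarrow> ('d set \<Rightarrow> real) \<Rightarrow> bool" where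
  "submodular_on C F \<longleftrightarrow>
    (\<forall>A B d. A \<subseteq> B \<and> B \<subseteq> C \<and> d \<in> C - B \<longrightarrow>
      F (A \<union> {d}) - F A \<ge> F (B \<union> {d}) - F B)"

end

theory Submission
  imports Defs
begin

text \<open>For nonnegative \<open>f\<close> the maximum \<open>m(S)\<close> satisfies \<open>m(S \<union> {d}) = max (f d) (m S)\<close>, even for empty
  \<open>S\<close>. So the marginal gain of \<open>d\<close> is the positive part of \<open>f d - m S\<close>, which is antitone in \<open>S\<close>
  because \<open>m\<close> is monotone. Both properties pass to sums with nonnegative weights.\<close>

text \<open>The sign condition reconciles the default value with the recursion: for empty
  \<open>S\<close> the right side is \<open>max (f d) 0\<close>, which is
  \<open>f d\<close>.\<close>

lemma max_or_zero_insert: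
  assumes "finite S" and "f d \<ge> 0"
  shows "max_or_zero f (insert d S) = max (f d) (max_or_zero f S)"
  using assms by (auto simp: max_or_zero_def)

lemma max_or_zero_mono:
  assumes "A \<subseteq> B" and "finite B" and "\<And>d. d \<in> B \<Longrightarrow> f d \<ge> 0"
  shows "max_or_zero f A \<le> max_or_zero f B"
proof (cases "A = {}")
  \<comment> \<open>The left side is the default 0. If \<open>B\<close> is nonempty, any of its
    elements witnesses that the maximum is at least 0.\<close>
  case True
  then show ?thesis
    using assms by (auto simp: max_or_zero_def Max_ge_iff)
next
  case False
  then show ?thesis
    using assms by (auto simp: max_or_zero_def intro!: Max_mono)
qed

lemma max_or_zero_gain_antimono:
  assumes "A \<subseteq> B" and "finite B" and "\<And>x. x \<in> insert d B \<Longrightarrow> f x \<ge> 0"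
  shows "max_or_zero f (insert d B) - max_or_zero f B
    \<le> max_or_zero f (insert d A) - max_or_zero f A"
proof -
  have "finite A"
    using assms(1,2) by (rule finite_subset)
  moreover have "max_or_zero f A \<le> max_or_zero f B"
    using assms by (intro max_or_zero_mono) auto
  \<comment> \<open>With \<open>a \<le> b\<close> for the two maxima, what remains is
    \<open>max (f d) b - b \<le> max (f d) a - a\<close>.\<close>
  ultimately show ?thesis
    using assms by (simp add: max_or_zero_insert)
qed

theorem theorem3p1:
  fixes C :: "'d set" and V :: "'v set"
    and q :: "'v \<Rightarrow> real" and \<rho> :: "'d \<Rightarrow> real" and rep :: "'d \<Rightarrow> 'v \<Rightarrow> real"
  assumes "finite C" and "finite V"
    and "\<And>v. v \<in> V \<Longrightarrow> q v \<ge> 0"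
    and "\<And>d. d \<in> C \<Longrightarrow> \<rho> d \<ge> 0"
    and "\<And>d v. d \<in> C \<Longrightarrow> v \<in> V \<Longrightarrow> rep d v \<ge> 0"
  shows "mono_on (Pow C) (coverage V q \<rho> rep) \<and> submodular_on C (coverage V q \<rho> rep)"
proof
  have nonneg: "sqrt (\<rho> d) * rep d v \<ge> 0" if "d \<in> C" "v \<in> V" for d v
    using assms(4,5) that by simp
  show "mono_on (Pow C) (coverage V q \<rho> rep)"
  proof (rule mono_onI)
    fix A B assume "A \<in> Pow C" "B \<in> Pow C" "A \<subseteq> B"
    then show "coverage V q \<rho> rep A \<le> coverage V q \<rho> rep B"
      unfolding coverage_def
      using assms(1,3) nonneg
      by (intro sum_mono mult_left_mono max_or_zero_mono) (auto intro: finite_subset)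
  qed
  show "submodular_on C (coverage V q \<rho> rep)"
    unfolding submodular_on_def
  proof (intro allI impI, elim conjE)
    fix A B d assume "A \<subseteq> B" "B \<subseteq> C" "d \<in> C - B"
    \<comment> \<open>Each difference of sums is merged into one sum of \<open>q v\<close> times a
      marginal gain, so the gains can be compared dimension by dimension.\<close>
    then show "coverage V q \<rho> rep (B \<union> {d}) - coverage V q \<rho> rep B
        \<le> coverage V q \<rho> rep (A \<union> {d}) - coverage V q \<rho> rep A"
      unfolding coverage_def sum_subtractf[symmetric] right_diff_distrib[symmetric]
        Un_insert_right Un_empty_right
      using assms(1,3) nonneg
      by (intro sum_mono mult_left_mono max_or_zero_gain_antimono) (auto intro: finite_subset)
  qed
qed

end
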